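(* Let $(G,d)$ be a $p$-uniformly convex space with constant $c>0$. Let $T_1:D\to G$ for $D\subset G$, let $T_2:D_1\to G$ for $D_1:=\{T_1x: x\in D\}$, define $\overline T:=T_2\circ T_1$, and let $\operatorname{Fix}\overline T\subset D$ and $\operatorname{Fix}T_1\cap\operatorname{Fix}T_2$ both be nonempty. If $T_1$ is pointwise $\alpha$-firmly nonexpansive at all $y\in\operatorname{Fix}\overline T$ with constant $\alpha_1$ on $D$, and if $T_2$ is pointwise $\alpha$-firmly nonexpansive at all $y\in\operatorname{Fix}\overline T$ with constant $\alpha_2$ on $D_1$, then the composite operator $\overline T$ is quasi $\alpha$-firmly nonexpansive on $D$ with constant $$\bar\alpha=\frac{\alpha_1+\alpha_2-2\alpha_1\alpha_2}{\frac c2\left(1-\alpha_1-\alpha_2+\alpha_1\alpha_2\right)+\alpha_1+\alpha_2-2\alpha_1\alpha_2}.$$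
   Context: Let $p\in(1,\infty)$. A metric space $(G,d)$ is $p$-uniformly convex with constant $c>0$ if it is a geodesic space and for all $x,y,z\in G$, $t\in[0,1]$: $$d(z,(1-t)x\oplus ty)^p\le(1-t)d(z,x)^p+td(z,y)^p-\tfrac c2t(1-t)d(x,y)^p,$$ where $(1-t)x\oplus ty$ is the point on the (unique) geodesic joining $x$ and $y$ at distance $t\,d(x,y)$ from $x$. $\operatorname{Fix}T=\{x:Tx=x\}$. $\psi_T^{(p,c)}(x,y)=\tfrac c2\left(d(Tx,x)^p+d(Ty,y)^p+d(Tx,Ty)^p+d(x,y)^p-d(Tx,y)^p-d(x,Ty)^p\right)$. A mapping $T$ is pointwise $\alpha$-firmly nonexpansive at $y\in D$ on $D$ with constant $\alpha\in(0,1)$ if $d(Tx,Ty)^p\le d(x,y)^p-\tfrac{1-\alpha}{\alpha}\psi_T^{(p,c)}(x,y)$ for all $x\in D$. $T$ is quasi $\alpha$-firmly nonexpansive on $D$ with constant $\alpha$ if $\emptyset\neq\operatorname{Fix}T\subset D$ and this holds at all $y\in\operatorname{Fix}T$ with the same constant $\alpha$. *)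

theory Defs
  imports "HOL-Analysis.Analysis"
begin

definition geodesic_path :: "'a set \<Rightarrow> ('a \<Rightarrow> 'a \<Rightarrow> real) \<Rightarrow> 'a \<Rightarrow> 'a \<Rightarrow> (real \<Rightarrow> 'a) \<Rightarrow> bool" where
  "geodesic_path G d x y \<gamma> \<longleftrightarrow>
     \<gamma> \<in> {0..d x y} \<rightarrow> G \<and> \<gamma> 0 = x \<and> \<gamma> (d x y) = y \<and>
     (\<forall>s\<in>{0..d x y}. \<forall>t\<in>{0..d x y}. d (\<gamma> s) (\<gamma> t) = \<bar>s - t\<bar>)"

definition geodesic_space :: "'a set \<Rightarrow> ('a \<Rightarrow> 'a \<Rightarrow> real) \<Rightarrow> bool" where
  "geodesic_space G d \<longleftrightarrow>
     Metric_space G d \<and> (\<forall>x\<in>G. \<forall>y\<in>G. \<exists>\<gamma>. geodesic_path G d x y \<gamma>)"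

(* The point (1-t)x (+) ty is \<gamma> (t * d x y) for a unit speed geodesic \<gamma> from x to y. The
   inequality is required along every such \<gamma>; p_uniformly_convex_geodesic_unique below shows
   that there is only one. *)
definition p_uniformly_convex ::
    "real \<Rightarrow> real \<Rightarrow> 'a set \<Rightarrow> ('a \<Rightarrow> 'a \<Rightarrow> real) \<Rightarrow> bool" where
  "p_uniformly_convex p c G d \<longleftrightarrow>
     1 < p \<and> 0 < c \<and> geodesic_space G d \<and>
     (\<forall>x\<in>G. \<forall>y\<in>G. \<forall>z\<in>G. \<forall>t\<in>{0..1}. \<forall>\<gamma>. geodesic_path G d x y \<gamma> \<longrightarrow>
        d z (\<gamma> (t * d x y)) powr p \<le>
          (1 - t) * d z x powr p + t * d z y powr p - c / 2 * t * (1 - t) * d x y powr p)"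

lemma p_uniformly_convex_geodesic_unique:
  assumes pc: "p_uniformly_convex p c G d" and xy: "x \<in> G" "y \<in> G"
    and g: "geodesic_path G d x y \<gamma>" and h: "geodesic_path G d x y \<delta>"
    and s: "s \<in> {0..d x y}"
  shows "\<gamma> s = \<delta> s"
proof (rule ccontr)
  assume ne: "\<gamma> s \<noteq> \<delta> s"
  interpret Metric_space G d
    using pc by (simp add: p_uniformly_convex_def geodesic_space_def)
  have p: "1 < p" and c: "0 < c" using pc by (auto simp: p_uniformly_convex_def)
  define m n where "m = \<gamma> s" and "n = \<delta> s"
  have mn: "m \<in> G" "n \<in> G" using g h s by (auto simp: geodesic_path_def m_def n_def Pi_iff)
  have dist: "d x (\<phi> s) = s \<and> d y (\<phi> s) = d x y - s" if "geodesic_path G d x y \<phi>" for \<phi>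
  proof -
    have "\<phi> 0 = x" "\<phi> (d x y) = y"
      and "\<And>u v. u \<in> {0..d x y} \<Longrightarrow> v \<in> {0..d x y} \<Longrightarrow> d (\<phi> u) (\<phi> v) = \<bar>u - v\<bar>"
      using that by (auto simp: geodesic_path_def)
    from this(1,2) this(3)[of 0 s] this(3)[of "d x y" s] s show ?thesis by simp
  qed
  have ds: "d x m = s" "d x n = s" "d y m = d x y - s" "d y n = d x y - s"
    using dist[OF g] dist[OF h] by (simp_all add: m_def n_def)
  obtain \<eta> where e: "geodesic_path G d m n \<eta>"
    using pc mn unfolding p_uniformly_convex_def geodesic_space_def by blast
  define q where "q = \<eta> (1 / 2 * d m n)"
  have q: "q \<in> G" using e by (auto simp: geodesic_path_def q_def Pi_iff)
  have pos: "0 < c / 8 * d m n powr p"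
    using ne mn c by (simp add: m_def n_def)
  have less: "d z q < r" if z: "z \<in> G" and r: "d z m = r" "d z n = r" for z r
  proof -
    have "d z q powr p \<le> (1 - 1 / 2) * d z m powr p + 1 / 2 * d z n powr p
        - c / 2 * (1 / 2) * (1 - 1 / 2) * d m n powr p"
    proof -
      have "(1 / 2 :: real) \<in> {0..1}" by simp
      with pc mn z e show ?thesis unfolding q_def p_uniformly_convex_def by blast
    qed
    then have "d z q powr p < r powr p" using pos by (simp add: r)
    moreover have "r powr p \<le> d z q powr p" if "r \<le> d z q"
      using that p r nonneg[of z m] by (intro powr_mono2) simp_all
    ultimately show ?thesis by fastforce
  qed
  have "d x q < s" "d y q < d x y - s" using less[of x s] less[of y "d x y - s"] ds xy by auto
  moreover have "d x y \<le> d x q + d y q" using triangle[of x q y] xy q by (simp add: commute)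
  ultimately show False by simp
qed

(* Mappings between subsets are total functions restricted to a domain D, so the domain has to be
   an argument here. *)
definition Fix :: "'a set \<Rightarrow> ('a \<Rightarrow> 'a) \<Rightarrow> 'a set" where
  "Fix D T = {x \<in> D. T x = x}"

definition psi ::
    "real \<Rightarrow> real \<Rightarrow> ('a \<Rightarrow> 'a \<Rightarrow> real) \<Rightarrow> ('a \<Rightarrow> 'a) \<Rightarrow> 'a \<Rightarrow> 'a \<Rightarrow> real" where
  "psi p c d T x y =
     c / 2 * (d (T x) x powr p + d (T y) y powr p + d (T x) (T y) powr p + d x y powr p
              - d (T x) y powr p - d x (T y) powr p)"

definition pointwise_firmly_nonexpansive ::
    "real \<Rightarrow> real \<Rightarrow> ('a \<Rightarrow> 'a \<Rightarrow> real) \<Rightarrow> real \<Rightarrow> 'a set \<Rightarrow> ('a \<Rightarrow> 'a) \<Rightarrow> 'a \<Rightarrow> bool" where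
  "pointwise_firmly_nonexpansive p c d \<alpha> D T y \<longleftrightarrow>
     0 < \<alpha> \<and> \<alpha> < 1 \<and> y \<in> D \<and>
     (\<forall>x\<in>D. d (T x) (T y) powr p \<le> d x y powr p - (1 - \<alpha>) / \<alpha> * psi p c d T x y)"

definition quasi_firmly_nonexpansive ::
    "real \<Rightarrow> real \<Rightarrow> ('a \<Rightarrow> 'a \<Rightarrow> real) \<Rightarrow> real \<Rightarrow> 'a set \<Rightarrow> ('a \<Rightarrow> 'a) \<Rightarrow> bool" where
  "quasi_firmly_nonexpansive p c d \<alpha> D T \<longleftrightarrow>
     Fix D T \<noteq> {} \<and> (\<forall>y\<in>Fix D T. pointwise_firmly_nonexpansive p c d \<alpha> D T y)"

end

theory Submission
  imports Defs
begin

text \<open>At a fixed point \<open>y\<close> of \<open>T\<close> the quantity \<open>\<psi>\<close> reduces to \<open>c/2 \<cdot> d(Tx,x)\<^sup>p\<close>. Testing both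
  inequalities at a common fixed point forces every fixed point of the composite to be fixed by
  both factors. Adding the two inequalities at such a point \<open>y\<close> gives, with
  \<open>k\<^sub>i = (1 - \<alpha>\<^sub>i)/\<alpha>\<^sub>i\<close>,
  \<open>d(Tx,y)\<^sup>p \<le> d(x,y)\<^sup>p - c/2 (k\<^sub>1 d(T\<^sub>1x,x)\<^sup>p + k\<^sub>2 d(Tx,T\<^sub>1x)\<^sup>p)\<close>,
  and uniform convexity at \<open>T\<^sub>1x\<close> along the geodesic from \<open>x\<close> to \<open>Tx\<close>, at the parameter
  \<open>t = k\<^sub>2/(k\<^sub>1 + k\<^sub>2)\<close>, bounds the bracket below by \<open>c/2 \<cdot> k\<^sub>1k\<^sub>2/(k\<^sub>1 + k\<^sub>2) \<cdot> d(Tx,x)\<^sup>p\<close>.\<close>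

text \<open>The left side of the convexity inequality is nonnegative, so discarding it bounds the
  weighted sum at \<open>z\<close> from below. The parameter \<open>t\<close> makes
  \<open>1 - t\<close> and \<open>t\<close> proportional to \<open>k1\<close> and \<open>k2\<close>;
  scaling by \<open>k1 + k2\<close> restores the weights.\<close>

lemma p_uniformly_convex_weighted_triangle:
  assumes pc: "p_uniformly_convex p c G d" and G: "x \<in> G" "y \<in> G" "z \<in> G"
    and k: "0 < k1" "0 < k2"
  shows "c / 2 * (k1 * k2 / (k1 + k2)) * d x y powr p \<le> k1 * d z x powr p + k2 * d z y powr p"
proof -
  define t where "t = k2 / (k1 + k2)"
  have t: "t \<in> {0..1}" and k1: "(k1 + k2) * (1 - t) = k1" and k2: "(k1 + k2) * t = k2"
    using k by (auto simp: t_def field_simps)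
  obtain \<gamma> where "geodesic_path G d x y \<gamma>"
    using pc G unfolding p_uniformly_convex_def geodesic_space_def by blast
  with pc G t have "d z (\<gamma> (t * d x y)) powr p
      \<le> (1 - t) * d z x powr p + t * d z y powr p - c / 2 * t * (1 - t) * d x y powr p"
    unfolding p_uniformly_convex_def by blast
  then have "c / 2 * t * (1 - t) * d x y powr p \<le> (1 - t) * d z x powr p + t * d z y powr p"
    using powr_ge_zero[of "d z (\<gamma> (t * d x y))" p] by linarith
  then have "(k1 + k2) * (c / 2 * t * (1 - t) * d x y powr p)
      \<le> (k1 + k2) * ((1 - t) * d z x powr p + t * d z y powr p)"
    using k by (intro mult_left_mono) auto
  also have "\<dots> = (k1 + k2) * (1 - t) * d z x powr p + (k1 + k2) * t * d z y powr p"
    by (simp only: distrib_left mult.assoc)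
  also have "(k1 + k2) * (c / 2 * t * (1 - t) * d x y powr p)
      = c / 2 * ((k1 + k2) * (1 - t) * t) * d x y powr p"
    by (simp only: mult_ac)
  finally show ?thesis
    by (simp only: k1 k2) (simp add: t_def)
qed

text \<open>With \<open>T y = y\<close> the four mixed terms cancel in pairs and
  \<open>d (T y) y powr p\<close> vanishes.\<close>

lemma psi_fixed_point:
  assumes "d y y = 0" and "T y = y"
  shows "psi p c d T x y = c / 2 * d (T x) x powr p"
  using assms by (simp add: psi_def)

lemma pointwise_firmly_nonexpansive_fixed_point:
  assumes "d y y = 0" and "T y = y"
  shows "pointwise_firmly_nonexpansive p c d \<alpha> D T y \<longleftrightarrow>
    0 < \<alpha> \<and> \<alpha> < 1 \<and> y \<in> D \<and>
    (\<forall>x\<in>D. d (T x) y powr p \<le> d x y powr p - (1 - \<alpha>) / \<alpha> * (c / 2 * d (T x) x powr p))"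
  using assms by (simp add: pointwise_firmly_nonexpansive_def psi_fixed_point[where T = T])

text \<open>The factors move \<open>y\<close> to \<open>T1 y\<close> and back, so both displacement
  terms equal \<open>d (T1 y) y powr p\<close>. In the sum of the two inequalities at
  \<open>z\<close> the distances to \<open>z\<close> cancel, leaving a positive multiple of this
  term at most 0.\<close>

lemma Fix_comp_firmly_nonexpansive:
  assumes ms: "Metric_space G d" and c: "0 < c" and DG: "D \<subseteq> G" and T1G: "T1 \<in> D \<rightarrow> G"
    and z: "z \<in> Fix D T1" "z \<in> Fix (T1 ` D) T2"
    and firm1: "pointwise_firmly_nonexpansive p c d \<alpha>1 D T1 z"
    and firm2: "pointwise_firmly_nonexpansive p c d \<alpha>2 (T1 ` D) T2 z"
    and y: "y \<in> Fix D (T2 \<circ> T1)"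
  shows "T1 y = y" and "T2 y = y"
proof -
  interpret Metric_space G d by (rule ms)
  have yD: "y \<in> D" and T21: "T2 (T1 y) = y" using y by (auto simp: Fix_def)
  have zz: "d z z = 0" "T1 z = z" "T2 z = z" using z DG by (auto simp: Fix_def)
  define k1 k2 where "k1 = (1 - \<alpha>1) / \<alpha>1" and "k2 = (1 - \<alpha>2) / \<alpha>2"
  have k: "0 < k1" "0 < k2"
    using firm1 firm2 by (auto simp: pointwise_firmly_nonexpansive_def k1_def k2_def)
  have "d (T1 y) z powr p \<le> d y z powr p - k1 * (c / 2 * d (T1 y) y powr p)"
    using firm1 yD zz by (simp add: pointwise_firmly_nonexpansive_fixed_point k1_def)
  moreover have "d y z powr p \<le> d (T1 y) z powr p - k2 * (c / 2 * d (T1 y) y powr p)"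
    using firm2 yD zz T21 by (force simp: pointwise_firmly_nonexpansive_fixed_point k2_def commute)
  ultimately have "(k1 + k2) * (c / 2) * d (T1 y) y powr p \<le> 0"
    by (simp add: algebra_simps)
  moreover have "0 < (k1 + k2) * (c / 2)" using k c by simp
  ultimately have "d (T1 y) y powr p \<le> 0"
    by (metis mult_pos_pos linorder_not_less)
  then have "d (T1 y) y = 0" by simp
  moreover have "y \<in> G" "T1 y \<in> G" using yD DG T1G by auto
  ultimately show "T1 y = y" by simp
  with T21 show "T2 y = y" by simp
qed

text \<open>The constant of the composite is the \<open>\<alpha>\<close> with \<open>(1 - \<alpha>)/\<alpha> = c/2 \<cdot> k\<^sub>1k\<^sub>2/(k\<^sub>1 + k\<^sub>2)\<close>.\<close>

lemma composite_constant:
  fixes \<alpha>1 \<alpha>2 c :: real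
  assumes c: "0 < c" and a1: "0 < \<alpha>1" "\<alpha>1 < 1" and a2: "0 < \<alpha>2" "\<alpha>2 < 1"
  defines "\<alpha> \<equiv> (\<alpha>1 + \<alpha>2 - 2 * \<alpha>1 * \<alpha>2) /
    (c / 2 * (1 - \<alpha>1 - \<alpha>2 + \<alpha>1 * \<alpha>2) + \<alpha>1 + \<alpha>2 - 2 * \<alpha>1 * \<alpha>2)"
    and "k1 \<equiv> (1 - \<alpha>1) / \<alpha>1" and "k2 \<equiv> (1 - \<alpha>2) / \<alpha>2"
  shows "0 < \<alpha>" and "\<alpha> < 1" and "(1 - \<alpha>) / \<alpha> = c / 2 * (k1 * k2 / (k1 + k2))"
proof -
  \<comment> \<open>Over the common denominator \<open>\<alpha>1 * \<alpha>2\<close>,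
    \<open>m\<close> and \<open>n\<close> are the numerators of \<open>k1 + k2\<close> and
    \<open>k1 * k2\<close>.\<close>
  define m where "m = \<alpha>1 + \<alpha>2 - 2 * \<alpha>1 * \<alpha>2"
  define n where "n = (1 - \<alpha>1) * (1 - \<alpha>2)"
  define w where "w = c / 2 * n"
  have \<alpha>: "\<alpha> = m / (w + m)"
    by (simp add: \<alpha>_def m_def n_def w_def algebra_simps)
  have m_alt: "m = \<alpha>1 * (1 - \<alpha>2) + \<alpha>2 * (1 - \<alpha>1)"
    by (simp add: m_def algebra_simps)
  have m: "0 < m" unfolding m_alt using a1 a2 by (intro add_pos_pos mult_pos_pos) auto
  have w: "0 < w" using a1 a2 c by (simp add: w_def n_def)
  show "0 < \<alpha>" "\<alpha> < 1" using m w by (auto simp: \<alpha>)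
  have "1 - \<alpha> = w / (w + m)" using m w by (simp add: \<alpha> field_simps)
  then have "(1 - \<alpha>) / \<alpha> = w / m" using m w by (simp add: \<alpha>)
  moreover have "k1 * k2 = n / (\<alpha>1 * \<alpha>2)" by (simp add: k1_def k2_def n_def)
  moreover have "k1 + k2 = m / (\<alpha>1 * \<alpha>2)"
    using a1 a2 by (simp add: k1_def k2_def m_alt field_simps)
  ultimately show "(1 - \<alpha>) / \<alpha> = c / 2 * (k1 * k2 / (k1 + k2))"
    using a1 a2 by (simp add: w_def)
qed

theorem theorem11:
  fixes G D :: "'a set" and d :: "'a \<Rightarrow> 'a \<Rightarrow> real" and T1 T2 :: "'a \<Rightarrow> 'a"
    and p c \<alpha>1 \<alpha>2 :: real
  assumes "p_uniformly_convex p c G d"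
    and "D \<subseteq> G" and "T1 \<in> D \<rightarrow> G" and "T2 \<in> T1 ` D \<rightarrow> G"
    and "Fix D (T2 \<circ> T1) \<noteq> {}"
    and "Fix D T1 \<inter> Fix (T1 ` D) T2 \<noteq> {}"
    and "\<forall>y\<in>Fix D (T2 \<circ> T1). pointwise_firmly_nonexpansive p c d \<alpha>1 D T1 y"
    and "\<forall>y\<in>Fix D (T2 \<circ> T1). pointwise_firmly_nonexpansive p c d \<alpha>2 (T1 ` D) T2 y"
  shows "quasi_firmly_nonexpansive p c d
    ((\<alpha>1 + \<alpha>2 - 2 * \<alpha>1 * \<alpha>2) /
      (c / 2 * (1 - \<alpha>1 - \<alpha>2 + \<alpha>1 * \<alpha>2) + \<alpha>1 + \<alpha>2 - 2 * \<alpha>1 * \<alpha>2))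
    D (T2 \<circ> T1)"
proof -
  interpret Metric_space G d
    using assms(1) by (simp add: p_uniformly_convex_def geodesic_space_def)
  have c: "0 < c" using assms(1) by (simp add: p_uniformly_convex_def)
  define \<alpha> where "\<alpha> = (\<alpha>1 + \<alpha>2 - 2 * \<alpha>1 * \<alpha>2) /
    (c / 2 * (1 - \<alpha>1 - \<alpha>2 + \<alpha>1 * \<alpha>2) + \<alpha>1 + \<alpha>2 - 2 * \<alpha>1 * \<alpha>2)"
  define k1 k2 where "k1 = (1 - \<alpha>1) / \<alpha>1" and "k2 = (1 - \<alpha>2) / \<alpha>2"
  obtain z where z: "z \<in> Fix D T1" "z \<in> Fix (T1 ` D) T2" using assms(6) by blast
  \<comment> \<open>Firmness is assumed only at fixed points of the composite; \<open>z\<close> is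
    one of them.\<close>
  then have zT: "z \<in> Fix D (T2 \<circ> T1)" by (simp add: Fix_def)
  with assms(7,8) have firm_z: "pointwise_firmly_nonexpansive p c d \<alpha>1 D T1 z"
    "pointwise_firmly_nonexpansive p c d \<alpha>2 (T1 ` D) T2 z" by auto
  then have a: "0 < \<alpha>1" "\<alpha>1 < 1" "0 < \<alpha>2" "\<alpha>2 < 1"
    by (auto simp: pointwise_firmly_nonexpansive_def)
  then have k: "0 < k1" "0 < k2" by (auto simp: k1_def k2_def)
  note \<alpha> = composite_constant[OF c a, folded \<alpha>_def k1_def k2_def]
  have "pointwise_firmly_nonexpansive p c d \<alpha> D (T2 \<circ> T1) y" if y: "y \<in> Fix D (T2 \<circ> T1)" for y
  proof -
    have yD: "y \<in> D" using y by (simp add: Fix_def)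
    have Ty: "T1 y = y" "T2 y = y"
      using Fix_comp_firmly_nonexpansive[OF Metric_space_axioms c assms(2,3) z firm_z y] by auto
    have yy: "d y y = 0" using yD assms(2) by auto
    have firm_y: "pointwise_firmly_nonexpansive p c d \<alpha>1 D T1 y"
      "pointwise_firmly_nonexpansive p c d \<alpha>2 (T1 ` D) T2 y" using assms(7,8) y by auto
    have "d (T2 (T1 x)) y powr p \<le> d x y powr p - (1 - \<alpha>) / \<alpha> * (c / 2 * d (T2 (T1 x)) x powr p)"
      if x: "x \<in> D" for x
    proof -
      have G: "x \<in> G" "T1 x \<in> G" "T2 (T1 x) \<in> G" using x assms(2-4) by auto
      have "d (T1 x) y powr p \<le> d x y powr p - k1 * (c / 2 * d (T1 x) x powr p)"
        using firm_y(1) x yy Ty by (simp add: pointwise_firmly_nonexpansive_fixed_point k1_def)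
      moreover have "d (T2 (T1 x)) y powr p
          \<le> d (T1 x) y powr p - k2 * (c / 2 * d (T1 x) (T2 (T1 x)) powr p)"
        using firm_y(2) x yy Ty
        by (simp add: pointwise_firmly_nonexpansive_fixed_point k2_def commute[of "T1 x" "T2 (T1 x)"])
      ultimately have "d (T2 (T1 x)) y powr p \<le> d x y powr p
          - c / 2 * (k1 * d (T1 x) x powr p + k2 * d (T1 x) (T2 (T1 x)) powr p)"
        by (simp add: algebra_simps)
      \<comment> \<open>The outer \<open>c / 2\<close> comes from \<open>psi\<close>; a second one,
        from uniform convexity, is absorbed into \<open>(1 - \<alpha>) / \<alpha>\<close>.\<close>
      also have "\<dots> \<le> d x y powr p - c / 2 * ((1 - \<alpha>) / \<alpha> * d x (T2 (T1 x)) powr p)"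
        unfolding \<alpha>(3)
        using p_uniformly_convex_weighted_triangle[OF assms(1) G(1,3,2) k] c
        by (intro diff_left_mono mult_left_mono) auto
      finally show ?thesis by (simp add: commute mult.left_commute)
    qed
    then show ?thesis
      using \<alpha>(1,2) yD yy Ty by (simp add: pointwise_firmly_nonexpansive_fixed_point)
  qed
  then show ?thesis
    using assms(5) unfolding quasi_firmly_nonexpansive_def \<alpha>_def by blast
qed

end
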